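(* Let $n\ge 1$ and let $\lambda=(\lambda_1\ge\lambda_2\ge\cdots\ge\lambda_\ell>0)$ be a partition of $n$. Let $x$ be a formal parameter. Then $$\frac{g_\lambda(x+1)-g_\lambda(x)}{H_\lambda}=\sum_{\mu\in\lambda\setminus 1}\frac{g_\mu(x)}{H_\mu},$$ where $g$, $H$ and $\lambda\setminus 1$ are as defined in the context.
   Context: For a partition $\lambda$ of $m$ (i.e. $|\lambda|=\lambda_1+\cdots+\lambda_\ell=m$), set $\lambda_i=0$ for $i>\ell(\lambda)$ and define the polynomial $g_\lambda(x)=\prod_{i=1}^{m}(x+\lambda_i-i)$ (the number of factors equals $m=|\lambda|$). For a box $(i,j)$ of the Ferrers diagram of $\lambda$ (row $i$, column $j$, $1\le j\le\lambda_i$), its hook length is $h_{(i,j)}(\lambda)=(\lambda_i-j)+(\lambda'_j-i)+1$, where $\lambda'_j=\#\{k:\lambda_k\ge j\}$; $H_\lambda$ denotes the product of the hook lengths of all boxes of $\lambda$. $\lambda\setminus 1$ denotes the set of all partitions $\mu$ of $n-1$ obtained from $\lambda$ by removing one corner box (i.e. removing the last box of a row $i$ with $\lambda_i>\lambda_{i+1}$). *)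

theory Defs
  imports Complex_Main "HOL-Computational_Algebra.Polynomial"
begin

definition is_partition :: "nat list \<Rightarrow> nat \<Rightarrow> bool" where
  "is_partition l n \<longleftrightarrow> sorted_wrt (\<ge>) l \<and> (\<forall>a\<in>set l. a > 0) \<and> sum_list l = n"

(* Rows are indexed from 1, and the parts beyond the length of the list are 0. *)
definition part :: "nat list \<Rightarrow> nat \<Rightarrow> nat" where
  "part l i = (if 1 \<le> i \<and> i \<le> length l then l ! (i - 1) else 0)"

definition conj_part :: "nat list \<Rightarrow> nat \<Rightarrow> nat" where
  "conj_part l j = card {k. 1 \<le> k \<and> part l k \<ge> j}"

definition boxes :: "nat list \<Rightarrow> (nat \<times> nat) set" where
  "boxes l = {(i, j). 1 \<le> i \<and> 1 \<le> j \<and> j \<le> part l i}"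

(* No truncation occurs in the subtractions when (i, j) is a box of a partition l. *)
definition hook_length :: "nat list \<Rightarrow> nat \<times> nat \<Rightarrow> nat" where
  "hook_length l = (\<lambda>(i, j). (part l i - j) + (conj_part l j - i) + 1)"

definition hook_prod :: "nat list \<Rightarrow> nat" where
  "hook_prod l = (\<Prod>b\<in>boxes l. hook_length l b)"

definition g_poly :: "nat list \<Rightarrow> rat poly" where
  "g_poly l = (\<Prod>i = 1..sum_list l. [:of_nat (part l i) - of_nat i, 1:])"

definition corner_removals :: "nat list \<Rightarrow> nat list set" where
  "corner_removals l = {m. is_partition m (sum_list l - 1) \<and>
     (\<exists>i\<ge>1. part l i > part l (i + 1) \<and>
        (\<forall>k. part m k = (if k = i then part l i - 1 else part l k)))}"

lemma finite_boxes: "finite (boxes l)"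
proof (rule finite_subset)
  show "boxes l \<subseteq> (SIGMA i:{1..length l}. {1..part l i})"
    by (auto simp: boxes_def part_def split: if_splits)
qed auto

lemma length_le_sum_list: "\<forall>a\<in>set l. a > 0 \<Longrightarrow> length l \<le> sum_list (l :: nat list)"
  by (induction l) auto

lemma finite_partitions: "finite {l. is_partition l n}"
proof (rule finite_subset)
  show "{l. is_partition l n} \<subseteq> {l. set l \<subseteq> {..n} \<and> length l \<le> n}"
    by (auto simp: is_partition_def length_le_sum_list member_le_sum_list)
qed (rule finite_lists_length_le, simp)

lemma finite_corner_removals: "finite (corner_removals l)"
  by (rule finite_subset[OF _ finite_partitions]) (auto simp: corner_removals_def)

end

theory Submission
  imports Defs
begin

text \<open>
  Put \<open>a\<^sub>i = \<lambda>\<^sub>i - i\<close> for \<open>1 \<le> i \<le> n\<close> and \<open>G = g\<^sub>\<lambda> = \<Prod>\<^sub>i (x + a\<^sub>i)\<close>. Lagrange interpolation at the points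
  \<open>-a\<^sub>r\<close> gives \<open>G(x + 1) - G(x) = \<Sum>\<^sub>r d\<^sub>r G(x) / (x + a\<^sub>r)\<close> with
  \<open>d\<^sub>r = \<Prod>\<^sub>j\<^sub>\<noteq>\<^sub>r (a\<^sub>r - 1 - a\<^sub>j) / (a\<^sub>r - a\<^sub>j)\<close>. Comparing the two leading coefficients and using
  \<open>\<Sum>\<^sub>i a\<^sub>i = - n (n - 1) / 2\<close> yields \<open>\<Sum>\<^sub>r d\<^sub>r = \<Sum>\<^sub>r (n + a\<^sub>r) d\<^sub>r\<close>, hence
  \<open>(x - n) (G(x + 1) - G(x)) = \<Sum>\<^sub>r (n + a\<^sub>r) d\<^sub>r (G(x) - G(x) / (x + a\<^sub>r))\<close>.
  If \<open>\<mu>\<close> arises from \<open>\<lambda>\<close> by removing the corner in row \<open>r\<close>, then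
  \<open>(x - n) g\<^sub>\<mu>(x) = G(x) - G(x) / (x + a\<^sub>r)\<close>, and Frobenius' formula
  \<open>H\<^sub>\<lambda> \<Prod>\<^sub>i\<^sub><\<^sub>j (a\<^sub>i - a\<^sub>j) = \<Prod>\<^sub>i (a\<^sub>i + n)!\<close> shows \<open>H\<^sub>\<lambda> / H\<^sub>\<mu> = (n + a\<^sub>r) d\<^sub>r\<close>. For rows without a corner this
  weight is zero, so the identity follows after cancelling \<open>x - n\<close>.
\<close>

section \<open>Top coefficients of products of linear factors and of their forward
  differences\<close>

abbreviation linear_prod :: "('i \<Rightarrow> 'a::comm_ring_1) \<Rightarrow> 'i set \<Rightarrow> 'a poly" where
  "linear_prod a A \<equiv> (\<Prod>i\<in>A. [:a i, 1:])"

lemma pCons_0_sum: "pCons 0 (\<Sum>r\<in>B. f r) = (\<Sum>r\<in>B. pCons 0 (f r))"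
  by (rule poly_eqI) (simp add: coeff_pCons coeff_sum split: nat.split)

lemma smult_sum_right: "smult c (\<Sum>i\<in>A. f i) = (\<Sum>i\<in>A. smult c (f i))"
  by (induction A rule: infinite_finite_induct) (simp_all add: smult_add_right)

lemma coeff_linear_mult:
  "coeff ([:b, 1:] * p) k = b * coeff p k + (case k of 0 \<Rightarrow> 0 | Suc j \<Rightarrow> coeff p j)"
  for p :: "'a::comm_ring_1 poly"
  by (cases k) (simp_all add: coeff_pCons)

lemma degree_prod_linear:
  fixes a :: "'i \<Rightarrow> 'a::field_char_0"
  shows "degree (linear_prod a A) = card A"
  by (subst degree_prod_eq_sum_degree) (auto simp: degree_pCons_eq_if)

lemma coeff_prod_linear:
  fixes a :: "'i \<Rightarrow> 'a::field_char_0"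
  assumes "finite A"
  shows "coeff (linear_prod a A) (card A) = 1"
    and "coeff (pCons 0 (linear_prod a A)) (card A) = (\<Sum>i\<in>A. a i)"
  using assms
proof (induction A)
  case empty
  { case 1 show ?case by simp next case 2 show ?case by simp }
next
  case (insert b A)
  have deg: "coeff (linear_prod a A) (Suc (card A)) = 0"
    by (rule coeff_eq_0) (simp add: degree_prod_linear)
  { case 1 show ?case
      using insert deg by (simp add: coeff_linear_mult del: mult_pCons_left)
  next
    case 2 show ?case
      using insert by (cases "card A") (simp_all add: coeff_linear_mult del: mult_pCons_left)
  }
qed

text \<open>A discrete Leibniz rule. Only \<open>p\<close> and its own difference occur on the
  right, so it serves as the step of an induction over the factors.\<close>

lemma forward_difference_insert:
  fixes p :: "'a::comm_ring_1 poly"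
  shows "pcompose ([:b, 1:] * p) [:1, 1:] - [:b, 1:] * p
    = p + [:b + 1, 1:] * (pcompose p [:1, 1:] - p)"
proof -
  have "[:b + 1, 1:] = [:b, 1:] + (1 :: 'a poly)"
    by (simp add: one_pCons)
  moreover have "pcompose [:b, 1:] [:1, 1:] = [:b + 1, 1:]"
    by (simp add: pcompose_pCons)
  ultimately show ?thesis
    by (simp only: pcompose_mult) (simp add: algebra_simps del: mult_pCons_left mult_pCons_right)
qed

text \<open>The shifts by \<open>pCons 0\<close> avoid truncated indices \<open>n - 1\<close> and \<open>n - 2\<close>, so that the
  formulas also hold for small \<open>n\<close>.\<close>

lemma coeff_forward_difference_prod_linear:
  fixes a :: "'i \<Rightarrow> 'a::field_char_0" and A :: "'i set"
  defines "n \<equiv> card A"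
  defines "D \<equiv> pcompose (linear_prod a A) [:1, 1:] - linear_prod a A"
  assumes "finite A"
  shows "k \<ge> n \<Longrightarrow> coeff D k = 0"
    and "coeff (pCons 0 D) n = of_nat n"
    and "coeff (pCons 0 (pCons 0 D)) n
      = of_nat n * (of_nat n - 1) / 2 + (of_nat n - 1) * (\<Sum>i\<in>A. a i)"
  using \<open>finite A\<close> unfolding n_def D_def
proof (induction A arbitrary: k)
  case empty
  { case 1 show ?case by (simp add: pcompose_1) next
    case 2 show ?case by (simp add: pcompose_1) next
    case 3 show ?case by (simp add: pcompose_1) }
next
  case (insert b A)
  define G where "G = linear_prod a A"
  define D where "D = pcompose G [:1, 1:] - G"
  have eq: "pcompose (linear_prod a (insert b A)) [:1, 1:] - linear_prod a (insert b A)
    = G + [:a b + 1, 1:] * D"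
    using insert.hyps unfolding D_def G_def
    by (simp only: prod.insert[OF insert.hyps] forward_difference_insert)
  have IH1: "coeff D k = 0" if "k \<ge> card A" for k
    using insert.IH(1)[OF that] by (simp only: D_def G_def)
  have IH2: "coeff (pCons 0 D) (card A) = of_nat (card A)"
    using insert.IH(2) by (simp only: D_def G_def)
  have IH3: "coeff (pCons 0 (pCons 0 D)) (card A)
      = of_nat (card A) * (of_nat (card A) - 1) / 2 + (of_nat (card A) - 1) * (\<Sum>i\<in>A. a i)"
    using insert.IH(3) by (simp only: D_def G_def)
  have G0: "coeff G k = 0" if "k > card A" for k
    using that by (intro coeff_eq_0) (simp add: G_def degree_prod_linear)
  have G1: "coeff G (card A) = 1" "coeff (pCons 0 G) (card A) = (\<Sum>i\<in>A. a i)"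
    using coeff_prod_linear[OF insert.hyps(1), of a] by (simp_all only: G_def)
  have card: "card (insert b A) = Suc (card A)"
    using insert.hyps by simp
  {
    case (1 k) then show ?case
      unfolding eq card using IH1 G0
      by (auto simp: coeff_linear_mult simp del: mult_pCons_left split: nat.splits)
  next
    case 2 show ?case
      unfolding eq card using IH1[of "card A"] IH2 G1(1)
      by (cases "card A") (simp_all add: coeff_linear_mult del: mult_pCons_left)
  next
    case 3 show ?case
    proof (cases "card A")
      case 0
      then have "A = {}" using insert.hyps by simp
      then show ?thesis unfolding eq card using 0 by simp
    next
      case (Suc m)
      show ?thesis
        unfolding eq card using IH2 IH3 G1 insert.hyps Suc
        by (cases m)
          (simp_all add: coeff_linear_mult field_simps del: mult_pCons_left)
    qed
  }
qed

section \<open>Lagrange interpolation of the forward difference\<close>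

text \<open>This is \<open>d\<^sub>r\<close>, the residue of \<open>G(x + 1) / G(x)\<close> at
  \<open>x = -a\<^sub>r\<close> when the \<open>a\<^sub>i\<close> are distinct.\<close>

definition lagrange_weight :: "('i \<Rightarrow> 'a::field) \<Rightarrow> 'i set \<Rightarrow> 'i \<Rightarrow> 'a" where
  "lagrange_weight a A r = (\<Prod>j\<in>A - {r}. (a r - 1 - a j) / (a r - a j))"

context
  fixes a :: "'i \<Rightarrow> 'a::field_char_0" and A :: "'i set"
  assumes fin: "finite A" and inj: "inj_on a A"
begin

text \<open>Both sides have degree below \<open>card A\<close> and agree at the
  \<open>card A\<close> distinct points \<open>- a s\<close>: there \<open>G\<close> vanishes, and
  so does every summand except the one with \<open>r = s\<close>.\<close>

lemma forward_difference_lagrange: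
  "pcompose (linear_prod a A) [:1, 1:] - linear_prod a A
    = (\<Sum>r\<in>A. smult (lagrange_weight a A r) (linear_prod a (A - {r})))"
  (is "?D = ?S")
proof (cases "A = {}")
  case True
  then show ?thesis by (simp add: pcompose_1)
next
  case False
  then have pos: "card A > 0"
    using fin by (simp add: card_gt_0_iff)
  have inj': "inj_on (\<lambda>i. - a i) A"
    using inj by (auto simp: inj_on_def)
  show ?thesis
  proof (rule poly_eqI_degree[where A = "(\<lambda>i. - a i) ` A"])
    have "degree ?D \<le> card A - 1"
      using coeff_forward_difference_prod_linear(1)[OF fin, of _ a]
      by (intro degree_le) auto
    then show "card ((\<lambda>i. - a i) ` A) > degree ?D"
      using pos by (simp add: card_image[OF inj'])
    have "degree ?S \<le> card A - 1"
      using fin by (intro degree_sum_le) (auto intro!: order.trans[OF degree_smult_le]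
          simp: degree_prod_linear)
    then show "card ((\<lambda>i. - a i) ` A) > degree ?S"
      using pos by (simp add: card_image[OF inj'])
  next
    fix x assume "x \<in> (\<lambda>i. - a i) ` A"
    then obtain s where s: "s \<in> A" "x = - a s" by auto
    have zero: "poly (linear_prod a B) (- a s) = 0" if "s \<in> B" "finite B" for B
      using that by (auto simp: poly_prod intro!: bexI[of _ s])
    have "poly ?S x = (\<Sum>r\<in>A. lagrange_weight a A r * poly (linear_prod a (A - {r})) (- a s))"
      by (simp add: poly_sum s)
    also have "\<dots> = (\<Sum>r\<in>A. if r = s
        then lagrange_weight a A s * poly (linear_prod a (A - {s})) (- a s) else 0)"
      using s fin by (intro sum.cong) (auto simp: zero)
    also have "\<dots> = lagrange_weight a A s * poly (linear_prod a (A - {s})) (- a s)"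
      using s fin by simp
    \<comment> \<open>The denominators of the weight cancel against the values of the linear
      factors, up to a sign that the numerators absorb.\<close>
    also have "\<dots> = (\<Prod>i\<in>A - {s}. a i - a s + 1)"
      unfolding lagrange_weight_def poly_prod prod.distrib[symmetric]
    proof (rule prod.cong)
      fix i assume "i \<in> A - {s}"
      then have "a s - a i \<noteq> 0" using inj s by (auto simp: inj_on_def)
      then show "(a s - 1 - a i) / (a s - a i) * poly [:a i, 1:] (- a s) = a i - a s + 1"
        by (simp add: field_simps)
    qed simp
    \<comment> \<open>The new factor \<open>i = s\<close> equals 1.\<close>
    also have "\<dots> = (\<Prod>i\<in>A. a i - a s + 1)"
      using s fin by (simp add: prod.remove[of A s])
    also have "\<dots> = poly ?D x"
      using zero[OF s(1) fin] s(2) by (simp add: poly_pcompose poly_prod algebra_simps)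
    finally show "poly ?D x = poly ?S x" ..
  qed
qed

text \<open>Compare the coefficients of degree \<open>n - 1\<close> and \<open>n - 2\<close> in the
  interpolation formula. The second one involves \<open>d\<^sub>r\<close> times the sum of all
  \<open>a\<^sub>i\<close> with \<open>i \<noteq> r\<close>, from which the first moment is
  solved.\<close>

lemma lagrange_weight_moments:
  "(\<Sum>r\<in>A. lagrange_weight a A r) = of_nat (card A)"
  "(\<Sum>r\<in>A. lagrange_weight a A r * a r)
    = (\<Sum>i\<in>A. a i) - of_nat (card A) * (of_nat (card A) - 1) / 2"
proof -
  let ?S = "\<Sum>r\<in>A. smult (lagrange_weight a A r) (linear_prod a (A - {r}))"
  note co = coeff_forward_difference_prod_linear(2,3)[OF fin, where a = a,
      unfolded forward_difference_lagrange]
  have 1: "coeff (pCons 0 (linear_prod a (A - {r}))) (card A) = 1" if "r \<in> A" for r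
    using coeff_prod_linear(1)[of "A - {r}" a] fin that card_Suc_Diff1[OF fin that]
    by (metis coeff_pCons_Suc finite_Diff)
  have 2: "coeff (pCons 0 (pCons 0 (linear_prod a (A - {r})))) (card A) = (\<Sum>i\<in>A. a i) - a r"
    if "r \<in> A" for r
    using coeff_prod_linear(2)[of "A - {r}" a] fin that card_Suc_Diff1[OF fin that]
    by (metis coeff_pCons_Suc finite_Diff sum_diff1)
  have shift: "pCons 0 ?S
      = (\<Sum>r\<in>A. smult (lagrange_weight a A r) (pCons 0 (linear_prod a (A - {r}))))"
    "pCons 0 (pCons 0 ?S)
      = (\<Sum>r\<in>A. smult (lagrange_weight a A r) (pCons 0 (pCons 0 (linear_prod a (A - {r})))))"
    by (simp_all add: pCons_0_sum)
  show s: "(\<Sum>r\<in>A. lagrange_weight a A r) = of_nat (card A)"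
    using co(1) unfolding shift(1) by (simp add: coeff_sum 1 del: smult_pCons)
  show "(\<Sum>r\<in>A. lagrange_weight a A r * a r)
      = (\<Sum>i\<in>A. a i) - of_nat (card A) * (of_nat (card A) - 1) / 2"
    using co(2) s unfolding shift(2)
    by (simp add: coeff_sum 2 right_diff_distrib sum_subtractf flip: sum_distrib_right
        del: smult_pCons) (simp add: algebra_simps)
qed

text \<open>Writing \<open>x - n = (x + a\<^sub>r) - (n + a\<^sub>r)\<close> turns each summand of
  the interpolation formula into a multiple of \<open>G\<close> minus a multiple of
  \<open>G / (x + a\<^sub>r)\<close>.\<close>

lemma forward_difference_lagrange_mult:
  assumes sum: "(\<Sum>i\<in>A. a i) = - (of_nat (card A) * (of_nat (card A) - 1) / 2)"
  defines "n \<equiv> of_nat (card A)"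
  shows "[:- n, 1:] * (pcompose (linear_prod a A) [:1, 1:] - linear_prod a A)
    = (\<Sum>r\<in>A. smult ((n + a r) * lagrange_weight a A r)
        (linear_prod a A - linear_prod a (A - {r})))"
proof -
  have "[:- n, 1:] * linear_prod a (A - {r})
      = linear_prod a A - smult (n + a r) (linear_prod a (A - {r}))" if "r \<in> A" for r
  proof -
    have "[:- n, 1:] = [:a r, 1:] - [:n + a r:]" by simp
    then show ?thesis
      by (simp only: left_diff_distrib prod.remove[OF fin that]) simp
  qed
  then have "[:- n, 1:] * (pcompose (linear_prod a A) [:1, 1:] - linear_prod a A)
    = (\<Sum>r\<in>A. smult (lagrange_weight a A r)
        (linear_prod a A - smult (n + a r) (linear_prod a (A - {r}))))"
    unfolding forward_difference_lagrange sum_distrib_left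
    by (intro sum.cong) (simp_all del: mult_pCons_left)
  also have "\<dots> = smult (\<Sum>r\<in>A. lagrange_weight a A r) (linear_prod a A)
      - (\<Sum>r\<in>A. smult ((n + a r) * lagrange_weight a A r) (linear_prod a (A - {r})))"
    by (simp add: smult_diff_right sum_subtractf smult_sum mult.commute)
  \<comment> \<open>The assumed value of the sum of the \<open>a\<^sub>i\<close> enters here: the
    moments give \<open>n * n - n * (n - 1) = n\<close> on the right.\<close>
  also have "(\<Sum>r\<in>A. lagrange_weight a A r) = (\<Sum>r\<in>A. (n + a r) * lagrange_weight a A r)"
  proof -
    have "(\<Sum>r\<in>A. (n + a r) * lagrange_weight a A r)
      = n * (\<Sum>r\<in>A. lagrange_weight a A r) + (\<Sum>r\<in>A. lagrange_weight a A r * a r)"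
      by (simp add: sum.distrib sum_distrib_left algebra_simps)
    moreover have "(\<Sum>r\<in>A. lagrange_weight a A r * a r) = - (n * (n - 1))"
      unfolding lagrange_weight_moments sum n_def by (simp add: field_simps)
    ultimately show ?thesis
      unfolding lagrange_weight_moments n_def by (simp add: algebra_simps)
  qed
  finally show ?thesis
    by (simp add: smult_diff_right sum_subtractf smult_sum)
qed

end

section \<open>Partitions as weakly decreasing sequences, and their conjugates\<close>

lemma part_antimono:
  assumes "is_partition l n" "1 \<le> i" "i \<le> j"
  shows "part l j \<le> part l i"
  using assms sorted_wrt_nth_less[of "(\<ge>)" l "i - 1" "j - 1"]
  by (cases "i = j") (auto simp: part_def is_partition_def)

lemma part_pos_iff:
  assumes "is_partition l n"
  shows "part l i > 0 \<longleftrightarrow> 1 \<le> i \<and> i \<le> length l"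
  using assms by (auto simp: part_def is_partition_def)

lemma part_eq_0_if_greater:
  assumes "is_partition l n" "n < i"
  shows "part l i = 0"
  using assms length_le_sum_list[of l] by (auto simp: part_def is_partition_def)

lemma sum_part:
  assumes "is_partition l n" "n \<le> N"
  shows "(\<Sum>i=1..N. part l i) = n"
proof -
  have "length l \<le> n"
    using assms length_le_sum_list[of l] by (auto simp: is_partition_def)
  then have "(\<Sum>i=1..N. part l i) = (\<Sum>i=1..length l. part l i)"
    using assms(2) by (intro sum.mono_neutral_right) (auto simp: part_def)
  also have "\<dots> = (\<Sum>i<length l. l ! i)"
    by (rule sum.reindex_bij_witness[of _ Suc "\<lambda>i. i - 1"]) (auto simp: part_def)
  also have "\<dots> = n"
    using assms by (simp add: is_partition_def sum_list_sum_nth atLeast0LessThan)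
  finally show ?thesis .
qed

lemma partition_eqI:
  assumes "is_partition l n" "is_partition m n'" and eq: "\<And>k. part l k = part m k"
  shows "l = m"
proof -
  have "i \<le> length l \<longleftrightarrow> i \<le> length m" if "1 \<le> i" for i
    using part_pos_iff[OF assms(1), of i] part_pos_iff[OF assms(2), of i] eq that by auto
  from this[of "length l"] this[of "length m"] have len: "length l = length m"
    by (cases "length l"; cases "length m") auto
  then show ?thesis
  proof (rule nth_equalityI)
    fix i assume "i < length l"
    then show "l ! i = m ! i" using eq[of "Suc i"] len by (simp add: part_def)
  qed
qed

text \<open>Builds the list of a partition from its sequence of parts. The condition
  \<open>f 0 = 0\<close> matches the default value of \<open>part\<close> at index 0.\<close>

lemma partition_of_antimono:
  fixes f :: "nat \<Rightarrow> nat"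
  assumes anti: "\<And>i j. 1 \<le> i \<Longrightarrow> i \<le> j \<Longrightarrow> f j \<le> f i"
    and zero: "\<And>i. N < i \<Longrightarrow> f i = 0" and "f 0 = 0"
  obtains m where "is_partition m (\<Sum>i=1..N. f i)" "\<And>k. part m k = f k"
proof -
  \<comment> \<open>\<open>L\<close> will be the number of parts: by monotonicity the positive
    values form an initial segment.\<close>
  have "\<exists>L\<le>N. \<forall>k\<ge>1. f k > 0 \<longleftrightarrow> k \<le> L"
    using zero
  proof (induction N)
    case 0
    then show ?case by auto
  next
    case (Suc N)
    show ?case
    proof (cases "f (Suc N) = 0")
      case True
      then have "\<And>i. N < i \<Longrightarrow> f i = 0"
        using Suc.prems by (metis Suc_lessI)
      then show ?thesis using Suc.IH by (meson le_SucI)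
    next
      case False
      then have "\<forall>k\<ge>1. f k > 0 \<longleftrightarrow> k \<le> Suc N"
        using Suc.prems anti[of _ "Suc N"] by (metis gr0I le_zero_eq not_le)
      then show ?thesis by blast
    qed
  qed
  then obtain L where L: "L \<le> N" "\<And>k. k \<ge> 1 \<Longrightarrow> f k > 0 \<longleftrightarrow> k \<le> L" by blast
  define m where "m = map f [1..<Suc L]"
  have "part m k = f k" for k
    using L(2)[of k] \<open>f 0 = 0\<close> by (cases "k = 0") (auto simp: part_def m_def simp del: upt_Suc)
  moreover have "sum_list m = (\<Sum>i=1..N. f i)"
  proof -
    have "sum_list m = (\<Sum>i=1..L. f i)"
      by (simp only: m_def interv_sum_list_conv_sum_set_nat set_upt atLeastLessThanSuc_atLeastAtMost)
    also have "\<dots> = (\<Sum>i=1..N. f i)"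
    proof (rule sum.mono_neutral_left)
      show "\<forall>i\<in>{1..N} - {1..L}. f i = 0"
      proof
        fix i assume "i \<in> {1..N} - {1..L}"
        then show "f i = 0" using L(2)[of i] by auto
      qed
    qed (use L(1) in auto)
    finally show ?thesis .
  qed
  moreover have "sorted_wrt (\<ge>) m"
    using anti by (auto simp: m_def sorted_wrt_iff_nth_less simp del: upt_Suc)
  moreover have "\<forall>a\<in>set m. a > 0"
    using L by (auto simp: m_def simp del: upt_Suc)
  ultimately show ?thesis
    by (intro that[of m]) (auto simp: is_partition_def)
qed

text \<open>Since the parts decrease, the rows counted by \<open>conj_part\<close> form an initial
  segment. With this equivalence, later arguments about conjugates avoid cardinalities.\<close>

lemma le_conj_part_iff:
  assumes "is_partition l n" "1 \<le> i" "1 \<le> j"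
  shows "i \<le> conj_part l j \<longleftrightarrow> j \<le> part l i"
proof -
  let ?S = "{k. 1 \<le> k \<and> part l k \<ge> j}"
  have fin: "finite ?S"
  proof (rule finite_subset)
    show "?S \<subseteq> {..n}"
    proof
      fix k assume "k \<in> ?S"
      then show "k \<in> {..n}"
        using part_eq_0_if_greater[OF assms(1), of k] assms(3) by (cases "k \<le> n") auto
    qed
  qed simp
  show ?thesis
  proof
    assume "j \<le> part l i"
    then have "{1..i} \<subseteq> ?S"
      using part_antimono[OF assms(1)] by (force intro: order_trans)
    then show "i \<le> conj_part l j"
      using card_mono[OF fin, of "{1..i}"] by (simp add: conj_part_def)
  next
    assume i: "i \<le> conj_part l j"
    show "j \<le> part l i"
    proof (rule ccontr)
      assume "\<not> j \<le> part l i"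
      then have "k < i" if "k \<in> ?S" for k
        using that part_antimono[OF assms(1,2), of k] by (cases "k < i") auto
      then have "?S \<subseteq> {1..<i}"
        by auto
      then have "conj_part l j \<le> i - 1"
        using card_mono[of "{1..<i}" ?S] by (simp add: conj_part_def)
      then show False using i assms by simp
    qed
  qed
qed

section \<open>Hook lengths of a row and Frobenius' formula\<close>

text \<open>\<open>R\<close> holds the hook lengths of row \<open>i\<close>, \<open>C\<close> the
  differences \<open>a\<^sub>i - a\<^sub>k\<close> for \<open>k > i\<close>. Both families are
  strictly monotone and they never meet, so together they have as many elements as the interval that
  contains them.\<close>

lemma hook_length_row_decomposition:
  fixes l :: "nat list" and N i :: nat
  assumes l: "is_partition l n" and N: "n \<le> N" and i: "1 \<le> i" "i \<le> N"
  defines "R \<equiv> (\<lambda>j. hook_length l (i, j)) ` {1..part l i}"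
    and "C \<equiv> (\<lambda>k. part l i + k - part l k - i) ` {i<..N}"
  shows "R \<union> C = {1..part l i + N - i}" "R \<inter> C = {}"
    "inj_on (\<lambda>j. hook_length l (i, j)) {1..part l i}"
    "inj_on (\<lambda>k. part l i + k - part l k - i) {i<..N}"
proof -
  note anti = part_antimono[OF l]
  have conj_i: "conj_part l j \<ge> i" if "j \<in> {1..part l i}" for j
    using that le_conj_part_iff[OF l i(1), of j] by auto
  have conj_N: "conj_part l j \<le> N" if "j \<ge> 1" for j
    using le_conj_part_iff[OF l, of "Suc N" j] part_eq_0_if_greater[OF l, of "Suc N"] N that
    by (cases "conj_part l j \<le> N") auto
  have conj_anti: "conj_part l j' \<le> conj_part l j" if "1 \<le> j" "j \<le> j'" for j j'
    using le_conj_part_iff[OF l, of "conj_part l j'" j] le_conj_part_iff[OF l, of "conj_part l j'" j'] that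
    by (cases "conj_part l j' = 0") auto
  have R_less: "hook_length l (i, j') < hook_length l (i, j)" if "1 \<le> j" "j < j'" "j' \<le> part l i" for j j'
    using conj_anti[of j j'] conj_i[of j] conj_i[of j'] that by (simp add: hook_length_def)
  show inj1: "inj_on (\<lambda>j. hook_length l (i, j)) {1..part l i}"
  proof (rule linorder_inj_onI)
    fix x y assume "x < y" "x \<in> {1..part l i}" "y \<in> {1..part l i}"
    then show "hook_length l (i, x) \<noteq> hook_length l (i, y)"
      using R_less[of x y] by simp
  qed auto
  have C_less: "part l i + k - part l k - i < part l i + k' - part l k' - i"
    if "i < k" "k < k'" for k k'
    using anti[of k k'] anti[of i k] i that by simp
  show inj2: "inj_on (\<lambda>k. part l i + k - part l k - i) {i<..N}"
  proof (rule linorder_inj_onI)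
    fix x y assume "x < y" "x \<in> {i<..N}" "y \<in> {i<..N}"
    then show "part l i + x - part l x - i \<noteq> part l i + y - part l y - i"
      using C_less[of x y] by simp
  qed auto
  show disj: "R \<inter> C = {}"
  proof -
    have "hook_length l (i, j) \<noteq> part l i + k - part l k - i"
      if "j \<in> {1..part l i}" "k \<in> {i<..N}" for j k
    \<comment> \<open>If row \<open>k\<close> reaches column \<open>j\<close>, the hook length
      exceeds the difference; otherwise it is smaller.\<close>
    proof (cases "j \<le> part l k")
      case True
      then have "k \<le> conj_part l j"
        using le_conj_part_iff[OF l, of k j] that by auto
      then show ?thesis
        using True that anti[of i k] i conj_i[of j] by (simp add: hook_length_def)
    next
      case False
      then have "conj_part l j < k"
        using le_conj_part_iff[OF l, of k j] that by auto
      then show ?thesis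
        using False that anti[of i k] i conj_i[of j] by (simp add: hook_length_def)
    qed
    then show ?thesis unfolding R_def C_def by auto
  qed
  have "R \<subseteq> {1..part l i + N - i}"
    unfolding R_def
  proof (rule image_subsetI)
    fix j assume "j \<in> {1..part l i}"
    then show "hook_length l (i, j) \<in> {1..part l i + N - i}"
      using conj_N[of j] conj_i[of j] by (auto simp: hook_length_def)
  qed
  moreover have "C \<subseteq> {1..part l i + N - i}"
    unfolding C_def
  proof (rule image_subsetI)
    fix k assume "k \<in> {i<..N}"
    then show "part l i + k - part l k - i \<in> {1..part l i + N - i}"
      using anti[of i k] i(1) by auto
  qed
  moreover have "card (R \<union> C) = part l i + N - i"
    using disj inj1 inj2 i by (subst card_Un_disjoint) (auto simp: R_def C_def card_image)
  ultimately show "R \<union> C = {1..part l i + N - i}"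
    by (intro card_subset_eq) auto
qed

lemma prod_hook_length_row:
  assumes l: "is_partition l n" and N: "n \<le> N" and i: "1 \<le> i" "i \<le> N"
  shows "(\<Prod>j=1..part l i. hook_length l (i, j)) * (\<Prod>k\<in>{i<..N}. part l i + k - part l k - i)
    = fact (part l i + N - i)"
proof -
  note D = hook_length_row_decomposition[OF assms]
  have "fact (part l i + N - i) = \<Prod>((\<lambda>j. hook_length l (i, j)) ` {1..part l i}
      \<union> (\<lambda>k. part l i + k - part l k - i) ` {i<..N})"
    unfolding D(1) by (simp add: fact_prod)
  also have "\<dots> = (\<Prod>j=1..part l i. hook_length l (i, j)) * (\<Prod>k\<in>{i<..N}. part l i + k - part l k - i)"
    using D(2-4) by (subst prod.union_disjoint) (auto simp: prod.reindex)
  finally show ?thesis ..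
qed

text \<open>These are the \<open>a\<^sub>i\<close>. They decrease strictly even along equal or zero
  parts, which makes the interpolation points distinct.\<close>

definition shifted_part :: "nat list \<Rightarrow> nat \<Rightarrow> rat" where
  "shifted_part l i = of_nat (part l i) - of_nat i"

lemma shifted_part_less:
  assumes "is_partition l n" "1 \<le> i" "i < j"
  shows "shifted_part l j < shifted_part l i"
  using part_antimono[OF assms(1), of i j] assms by (simp add: shifted_part_def)

text \<open>Multiply the row identities over all rows. As \<open>N\<close> may exceed the size, a
  partition and its corner removals can be compared with the same number of rows.\<close>

lemma hook_prod_frobenius:
  assumes l: "is_partition l n" and N: "n \<le> N"
  shows "of_nat (hook_prod l) * (\<Prod>i=1..N. \<Prod>k\<in>{i<..N}. shifted_part l i - shifted_part l k)
    = (\<Prod>i=1..N. fact (part l i + N - i))"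
proof -
  have "boxes l = (SIGMA i:{1..N}. {1..part l i})"
    using part_eq_0_if_greater[OF l] N
    by (fastforce simp: boxes_def intro: leI)
  then have "hook_prod l = (\<Prod>i=1..N. \<Prod>j=1..part l i. hook_length l (i, j))"
    unfolding hook_prod_def by (simp add: prod.Sigma)
  moreover have "shifted_part l i - shifted_part l k = of_nat (part l i + k - part l k - i)"
    if "i \<in> {1..N}" "k \<in> {i<..N}" for i k
    using part_antimono[OF l, of i k] that by (simp add: shifted_part_def of_nat_diff)
  ultimately have "of_nat (hook_prod l) * (\<Prod>i=1..N. \<Prod>k\<in>{i<..N}. shifted_part l i - shifted_part l k)
    = of_nat (\<Prod>i=1..N. (\<Prod>j=1..part l i. hook_length l (i, j)) *
        (\<Prod>k\<in>{i<..N}. part l i + k - part l k - i))"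
    by (simp add: prod.distrib)
  also have "\<dots> = of_nat (\<Prod>i=1..N. fact (part l i + N - i))"
    using prod_hook_length_row[OF assms] by (intro arg_cong[of _ _ of_nat] prod.cong) auto
  finally show ?thesis by simp
qed

lemma hook_prod_pos: "hook_prod l > 0"
  by (auto simp: hook_prod_def hook_length_def intro!: prod_pos)

section \<open>Removing a corner: hook products, vanishing weights and \<open>g_poly\<close>\<close>

text \<open>Only the pairs containing \<open>r\<close> change. Where \<open>r\<close> is the second
  index, numerator and denominator of the quotient both change sign, so each
  \<open>j \<noteq> r\<close> contributes the same expression.\<close>

lemma prod_pairs_fun_upd:
  fixes a :: "nat \<Rightarrow> 'a::field"
  assumes inj: "inj_on a {1..N}" and r: "r \<in> {1..N}"
  shows "(\<Prod>i=1..N. \<Prod>k\<in>{i<..N}. (a(r := y)) i - (a(r := y)) k)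
    = (\<Prod>i=1..N. \<Prod>k\<in>{i<..N}. a i - a k) * (\<Prod>j\<in>{1..N} - {r}. (y - a j) / (a r - a j))"
proof -
  define q where "q i k = ((a(r := y)) i - (a(r := y)) k) / (a i - a k)" for i k
  have ne: "a i - a k \<noteq> 0" if "i \<in> {1..N}" "k \<in> {i<..N}" for i k
    using inj_onD[OF inj, of i k] that by auto
  have row: "(\<Prod>k\<in>{i<..N}. q i k) = (if i < r then (y - a i) / (a r - a i) else 1)"
    if i: "i \<in> {1..N} - {r}" for i
  proof -
    have "(\<Prod>k\<in>{i<..N}. q i k) = (\<Prod>k\<in>{i<..N}. if k = r then (y - a i) / (a r - a i) else 1)"
    proof (rule prod.cong)
      fix k assume "k \<in> {i<..N}"
      then show "q i k = (if k = r then (y - a i) / (a r - a i) else 1)"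
        using ne[of i k] i minus_divide_divide[of "y - a i" "a r - a i"] by (auto simp: q_def)
    qed simp
    then show ?thesis using r i by simp
  qed
  have "(\<Prod>i=1..N. \<Prod>k\<in>{i<..N}. q i k)
    = (\<Prod>k\<in>{r<..N}. q r k) * (\<Prod>i\<in>{1..N} - {r}. \<Prod>k\<in>{i<..N}. q i k)"
    using r by (simp add: prod.remove)
  \<comment> \<open>Row \<open>r\<close> supplies the indices above \<open>r\<close>, the other rows
    those below; padding with 1 lets both products run over the same set.\<close>
  also have "(\<Prod>k\<in>{r<..N}. q r k) = (\<Prod>i\<in>{1..N} - {r}. if i < r then 1 else (y - a i) / (a r - a i))"
    using r by (intro prod.mono_neutral_cong_left) (auto simp: q_def)
  also have "(\<Prod>i\<in>{1..N} - {r}. \<Prod>k\<in>{i<..N}. q i k)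
    = (\<Prod>i\<in>{1..N} - {r}. if i < r then (y - a i) / (a r - a i) else 1)"
    using row by (rule prod.cong[OF refl])
  also have "(\<Prod>i\<in>{1..N} - {r}. if i < r then 1 else (y - a i) / (a r - a i)) * \<dots>
    = (\<Prod>j\<in>{1..N} - {r}. (y - a j) / (a r - a j))"
    unfolding prod.distrib[symmetric] by (intro prod.cong) auto
  finally have "(\<Prod>i=1..N. \<Prod>k\<in>{i<..N}. a i - a k) * (\<Prod>j\<in>{1..N} - {r}. (y - a j) / (a r - a j))
    = (\<Prod>i=1..N. \<Prod>k\<in>{i<..N}. (a i - a k) * q i k)"
    by (simp add: prod.distrib)
  also have "\<dots> = (\<Prod>i=1..N. \<Prod>k\<in>{i<..N}. (a(r := y)) i - (a(r := y)) k)"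
    using ne by (intro prod.cong) (auto simp: q_def)
  finally show ?thesis ..
qed

text \<open>Divide Frobenius' formulas for \<open>l\<close> and \<open>m\<close>, both taken with
  \<open>n\<close> rows: the factorials differ only in row \<open>r\<close>, by the factor
  \<open>n + a\<^sub>r\<close>, and the difference products by \<open>d\<^sub>r\<close>.\<close>

lemma hook_prod_corner_removal:
  assumes l: "is_partition l n" and m: "is_partition m n'" "n' \<le> n"
    and r: "r \<in> {1..n}" "part l r > 0"
    and part_m: "\<And>k. part m k = (if k = r then part l r - 1 else part l k)"
  shows "of_nat (hook_prod l)
    = (of_nat n + shifted_part l r) * lagrange_weight (shifted_part l) {1..n} r * of_nat (hook_prod m)"
proof -
  have inj: "inj_on (shifted_part l) {1..n}"
    by (rule linorder_inj_onI) (use shifted_part_less[OF l] in fastforce)+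
  let ?V = "\<lambda>a :: nat \<Rightarrow> rat. \<Prod>i=1..n. \<Prod>k\<in>{i<..n}. a i - a k"
  have shifted_m: "shifted_part m = (shifted_part l)(r := shifted_part l r - 1)"
    using r by (auto simp: fun_eq_iff shifted_part_def part_m of_nat_diff)
  have V: "?V (shifted_part m) = ?V (shifted_part l) * lagrange_weight (shifted_part l) {1..n} r"
    unfolding shifted_m prod_pairs_fun_upd[OF inj r(1)] by (simp add: lagrange_weight_def)
  have V0: "?V (shifted_part l) \<noteq> 0"
    using shifted_part_less[OF l] by (fastforce simp: prod_zero_iff)
  have "(\<Prod>i=1..n. fact (part l i + n - i) :: rat)
    = fact (part l r + n - r) * (\<Prod>i\<in>{1..n} - {r}. fact (part l i + n - i))"
    using r by (simp add: prod.remove)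
  also have "fact (part l r + n - r) = (of_nat n + shifted_part l r) * (fact (part m r + n - r) :: rat)"
  proof -
    have "part l r + n - r = Suc (part m r + n - r)"
      using r by (cases "part l r") (auto simp: part_m Suc_diff_le)
    moreover have "of_nat (Suc (part m r + n - r)) = of_nat n + shifted_part l r"
      using r by (simp add: part_m shifted_part_def of_nat_diff)
    ultimately show ?thesis by (simp only: fact_Suc)
  qed
  also have "(\<Prod>i\<in>{1..n} - {r}. fact (part l i + n - i) :: rat)
    = (\<Prod>i\<in>{1..n} - {r}. fact (part m i + n - i))"
    by (rule prod.cong) (auto simp: part_m)
  also have "(of_nat n + shifted_part l r) * fact (part m r + n - r) * \<dots>
    = (of_nat n + shifted_part l r) * (\<Prod>i=1..n. fact (part m i + n - i))"
    using r by (simp add: prod.remove)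
  finally have "of_nat (hook_prod l) * ?V (shifted_part l)
    = (of_nat n + shifted_part l r) * (of_nat (hook_prod m) * ?V (shifted_part m))"
    by (simp only: hook_prod_frobenius[OF l order.refl] hook_prod_frobenius[OF m])
  then have "of_nat (hook_prod l) * ?V (shifted_part l)
    = (of_nat n + shifted_part l r) * lagrange_weight (shifted_part l) {1..n} r
      * of_nat (hook_prod m) * ?V (shifted_part l)"
    unfolding V by (simp add: mult_ac)
  then show ?thesis using V0 by simp
qed

text \<open>For \<open>r = n\<close> the part is 0, so \<open>n + a\<^sub>r = 0\<close>. For
  \<open>r < n\<close> the next part is equal, and the factor \<open>j = r + 1\<close> of the weight
  vanishes.\<close>

lemma noncorner_weight_eq_0:
  assumes l: "is_partition l n" and r: "r \<in> {1..n}" and nc: "\<not> part l r > part l (r + 1)"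
  shows "(of_nat n + shifted_part l r) * lagrange_weight (shifted_part l) {1..n} r = 0"
proof (cases "r = n")
  case True
  then show ?thesis
    using nc part_eq_0_if_greater[OF l, of "n + 1"] by (simp add: shifted_part_def)
next
  case False
  have "part l (r + 1) = part l r"
    using nc part_antimono[OF l, of r "r + 1"] r by auto
  then have "shifted_part l r - 1 - shifted_part l (r + 1) = 0"
    by (simp add: shifted_part_def)
  then have "lagrange_weight (shifted_part l) {1..n} r = 0"
    unfolding lagrange_weight_def using r False by (intro prod_zero bexI[of _ "r + 1"]) auto
  then show ?thesis by simp
qed

text \<open>Corner removals correspond bijectively to corner rows, so the sum can be reindexed by
  rows.\<close>

lemma sum_corner_removals:
  fixes F :: "nat list \<Rightarrow> 'a::comm_monoid_add"
  assumes l: "is_partition l n"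
    and F: "\<And>m r. \<lbrakk>is_partition m (n - 1); r \<in> {1..n}; part l r > part l (r + 1);
      \<And>k. part m k = (if k = r then part l r - 1 else part l k)\<rbrakk> \<Longrightarrow> F m = f r"
  shows "(\<Sum>m\<in>corner_removals l. F m) = (\<Sum>r\<in>{r \<in> {1..n}. part l r > part l (r + 1)}. f r)"
proof -
  let ?R = "{r \<in> {1..n}. part l r > part l (r + 1)}"
  let ?p = "\<lambda>m r. \<forall>k. part m k = (if k = r then part l r - 1 else part l k)"
  have n: "sum_list l = n" using l by (simp add: is_partition_def)
  have "\<exists>m. is_partition m (n - 1) \<and> ?p m r" if r: "r \<in> ?R" for r
  proof -
    let ?f = "\<lambda>k. if k = r then part l r - 1 else part l k"
    \<comment> \<open>The critical case is \<open>i = r < j\<close>, where the corner condition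
      gives \<open>part l j \<le> part l (r + 1) < part l r\<close>.\<close>
    have "?f j \<le> ?f i" if "1 \<le> i" "i \<le> j" for i j
      using part_antimono[OF l that] part_antimono[OF l, of "r + 1" j] r that by auto
    moreover have "?f i = 0" if "n < i" for i
      using that r part_eq_0_if_greater[OF l] by auto
    moreover have "?f 0 = 0" using r by (auto simp: part_def)
    ultimately obtain m where m: "is_partition m (\<Sum>i=1..n. ?f i)" "\<And>k. part m k = ?f k"
      using partition_of_antimono[of ?f n] by blast
    have "(\<Sum>i=1..n. ?f i) = part l r - 1 + (\<Sum>i\<in>{1..n} - {r}. part l i)"
      using r by (simp add: sum.remove[of _ r])
    moreover have "part l r + (\<Sum>i\<in>{1..n} - {r}. part l i) = n"
      using r sum_part[OF l order.refl] by (simp add: sum.remove[of _ r])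
    ultimately have "(\<Sum>i=1..n. ?f i) = n - 1" using r by auto
    then show ?thesis using m by auto
  qed
  then obtain h where h: "\<And>r. r \<in> ?R \<Longrightarrow> is_partition (h r) (n - 1) \<and> ?p (h r) r"
    by metis
  have "inj_on h ?R"
  proof (rule inj_onI)
    fix r s assume rs: "r \<in> ?R" "s \<in> ?R" "h r = h s"
    have "part (h r) r = part l r - 1"
      using h[OF rs(1)] by simp
    moreover have "part (h s) r = (if r = s then part l s - 1 else part l r)"
      using h[OF rs(2)] by simp
    moreover have "part l r > 0" using rs by simp
    ultimately show "r = s" using rs(3) by (auto split: if_splits)
  qed
  moreover have "h ` ?R = corner_removals l"
  proof
    show "h ` ?R \<subseteq> corner_removals l"
      using h unfolding corner_removals_def n by fastforce
    show "corner_removals l \<subseteq> h ` ?R"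
    proof
      fix m assume "m \<in> corner_removals l"
      then obtain r where r: "is_partition m (n - 1)" "r \<ge> 1" "part l r > part l (r + 1)" "?p m r"
        unfolding corner_removals_def n by auto
      then have "r \<in> ?R"
        using part_eq_0_if_greater[OF l, of r] by (cases "r \<le> n") auto
      moreover from this have "m = h r"
        using r h by (intro partition_eqI[of m "n - 1" "h r" "n - 1"]) auto
      ultimately show "m \<in> h ` ?R" by blast
    qed
  qed
  ultimately have "(\<Sum>m\<in>corner_removals l. F m) = (\<Sum>r\<in>?R. F (h r))"
    using sum.reindex[of h ?R F] by simp
  also have "\<dots> = (\<Sum>r\<in>?R. f r)"
    using h by (intro sum.cong refl F) auto
  finally show ?thesis .
qed

text \<open>\<open>g_poly m\<close> has only \<open>n - 1\<close> factors. Since \<open>m\<close>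
  has size \<open>n - 1\<close>, its \<open>n\<close>-th part is 0, so \<open>x - n\<close> is
  exactly the missing factor; then only the factor of row \<open>r\<close> differs from that of
  \<open>l\<close>.\<close>

lemma g_poly_corner_removal:
  assumes "n \<ge> 1" and l: "is_partition l n" and m: "is_partition m (n - 1)"
    and r: "r \<in> {1..n}" "part l r > 0"
    and part_m: "\<And>k. part m k = (if k = r then part l r - 1 else part l k)"
  shows "[:- of_nat n, 1:] * g_poly m
    = linear_prod (shifted_part l) {1..n} - linear_prod (shifted_part l) ({1..n} - {r})"
proof -
  have "sum_list m = n - 1" using m by (simp add: is_partition_def)
  then have "g_poly m = linear_prod (shifted_part m) {1..n - 1}"
    by (simp add: g_poly_def shifted_part_def)
  moreover have "[:- of_nat n, 1:] = [:shifted_part m n, 1:]"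
    using part_eq_0_if_greater[OF m, of n] \<open>n \<ge> 1\<close> by (simp add: shifted_part_def)
  ultimately have "[:- of_nat n, 1:] * g_poly m = linear_prod (shifted_part m) {1..n}"
    using \<open>n \<ge> 1\<close> by (cases n) (simp_all add: mult.commute del: mult_pCons_left mult_pCons_right)
  also have "\<dots> = [:shifted_part m r, 1:] * linear_prod (shifted_part m) ({1..n} - {r})"
    using r by (subst prod.remove[of _ r]) auto
  also have "linear_prod (shifted_part m) ({1..n} - {r}) = linear_prod (shifted_part l) ({1..n} - {r})"
    by (rule prod.cong) (auto simp: shifted_part_def part_m)
  also have "[:shifted_part m r, 1:] = [:shifted_part l r, 1:] - 1"
    using r by (simp add: shifted_part_def part_m of_nat_diff one_pCons)
  also have "([:shifted_part l r, 1:] - 1) * linear_prod (shifted_part l) ({1..n} - {r})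
    = linear_prod (shifted_part l) {1..n} - linear_prod (shifted_part l) ({1..n} - {r})"
    using r by (subst (2) prod.remove[of _ r]) (auto simp: left_diff_distrib simp del: mult_pCons_left)
  finally show ?thesis .
qed

theorem theorem1p1:
  fixes n :: nat and l :: "nat list"
  assumes "n \<ge> 1" and "is_partition l n"
  shows "smult (1 / of_nat (hook_prod l)) (pcompose (g_poly l) [:1, 1:] - g_poly l) =
    (\<Sum>m\<in>corner_removals l. smult (1 / of_nat (hook_prod m)) (g_poly m))"
proof -
  note l = \<open>is_partition l n\<close>
  let ?c = "shifted_part l"
  let ?G = "linear_prod ?c"
  let ?w = "\<lambda>r. (of_nat n + ?c r) * lagrange_weight ?c {1..n} r"
  let ?R = "{r \<in> {1..n}. part l r > part l (r + 1)}"
  have inj: "inj_on ?c {1..n}"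
    by (rule linorder_inj_onI) (use shifted_part_less[OF l] in fastforce)+
  have g: "g_poly l = ?G {1..n}"
    using l by (simp add: g_poly_def shifted_part_def is_partition_def)
  \<comment> \<open>The parts sum to \<open>n\<close> and the indices to
    \<open>n (n + 1) / 2\<close>, which gives the hypothesis of
    \<open>forward_difference_lagrange_mult\<close>.\<close>
  have "(\<Sum>i=1..n. ?c i) = of_nat (\<Sum>i=1..n. part l i) - of_nat (\<Sum>i=1..n. i)"
    by (simp add: shifted_part_def sum_subtractf)
  also have "\<dots> = of_nat n - of_nat n * (of_nat n + 1) / 2"
    using sum_part[OF l order.refl] double_gauss_sum_from_Suc_0[of n, where 'a = rat]
    by (simp add: field_simps)
  finally have sum: "(\<Sum>i=1..n. ?c i) = - (of_nat (card {1..n}) * (of_nat (card {1..n}) - 1) / 2)"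
    by (simp add: field_simps)
  have "[:- of_nat n, 1:] * (\<Sum>m\<in>corner_removals l. smult (1 / of_nat (hook_prod m)) (g_poly m))
    = (\<Sum>m\<in>corner_removals l. smult (1 / of_nat (hook_prod m)) ([:- of_nat n, 1:] * g_poly m))"
    by (simp add: sum_distrib_left del: mult_pCons_left)
  also have "\<dots> = (\<Sum>r\<in>?R. smult (?w r / of_nat (hook_prod l)) (?G {1..n} - ?G ({1..n} - {r})))"
  proof (rule sum_corner_removals[OF l])
    fix m r
    assume m: "is_partition m (n - 1)" and r: "r \<in> {1..n}" "part l r > part l (r + 1)"
      and part_m: "\<And>k. part m k = (if k = r then part l r - 1 else part l k)"
    have r': "part l r > 0" using r by simp
    have "1 / of_nat (hook_prod m) = ?w r / of_nat (hook_prod l)"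
      using hook_prod_corner_removal[OF l m _ r(1) r' part_m] hook_prod_pos[of l] hook_prod_pos[of m]
      by (auto simp: field_simps)
    then show "smult (1 / of_nat (hook_prod m)) ([:- of_nat n, 1:] * g_poly m)
      = smult (?w r / of_nat (hook_prod l)) (?G {1..n} - ?G ({1..n} - {r}))"
      by (simp only: g_poly_corner_removal[OF assms m r(1) r' part_m])
  qed
  \<comment> \<open>Rows without a corner have weight zero and may be added.\<close>
  also have "\<dots> = (\<Sum>r\<in>{1..n}. smult (?w r / of_nat (hook_prod l)) (?G {1..n} - ?G ({1..n} - {r})))"
    using noncorner_weight_eq_0[OF l] by (intro sum.mono_neutral_left) auto
  also have "\<dots> = smult (1 / of_nat (hook_prod l))
      (\<Sum>r\<in>{1..n}. smult (?w r) (?G {1..n} - ?G ({1..n} - {r})))"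
    by (simp add: smult_sum_right)
  also have "\<dots> = smult (1 / of_nat (hook_prod l))
      ([:- of_nat n, 1:] * (pcompose (g_poly l) [:1, 1:] - g_poly l))"
    unfolding g using forward_difference_lagrange_mult[OF _ inj sum] by simp
  also have "\<dots> = [:- of_nat n, 1:] *
      smult (1 / of_nat (hook_prod l)) (pcompose (g_poly l) [:1, 1:] - g_poly l)"
    by (simp del: mult_pCons_left)
  \<comment> \<open>Cancels the nonzero polynomial \<open>x - n\<close>.\<close>
  finally show ?thesis
    by (subst (asm) mult_cancel_left) simp
qed

end
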